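(* Let $x=(\,x_0^-,x_0^+\mid x_1^-,x_1^+\mid\ldots\,)$ be a member of $\nu K$, where $K$ is a loop-free unital free augmented directed complex. (1) There are networks $G_q^-(x)$ and $G_q^+(x)$ for $q\geq 0$ as follows (with $\alpha=\pm$): the edges of $G_q^\alpha(x)$ correspond to the $q$-dimensional basis elements which are terms in $g_q^\alpha(x)$; the vertices in $G_q^\alpha(x)$ correspond to the $(q+1)$-dimensional basis elements which are terms in $x_{q+1}^\alpha$; if a vertex $v$ in $G_q^\alpha(x)$ corresponds to a basis element $a$, then the edges with target $v$ correspond to the terms of $\partial^-a$ and the edges with source $v$ correspond to the terms of $\partial^+a$. (2) There exists $n$ such that $G_q^\alpha(x)$ is empty for all $q>n$ and both signs $\alpha$. (3) The networks $G_q^\alpha(x)$ are acyclic for all $q\geq 0$ and both signs $\alpha$. (4) The networks $G_0^\alpha(x)$ are linear for both signs $\alpha$. (5) For $q\geq 0$ and each sign $\alpha$, the input edges of $G_{q+1}^\alpha(x)$ correspond to the terms of $x_{q+1}^-$, and the output edges of $G_{q+1}^\alpha(x)$ correspond to the terms of $x_{q+1}^+$. These correspondences induce bijections from the vertices of $G_q^-(x)$ to the input edges of $G_{q+1}^\alpha(x)$ and from the vertices of $G_q^+(x)$ to the output edges of $G_{q+1}^\alpha(x)$.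
   Context: A *free augmented directed complex* $K$ is an augmented chain complex of free abelian groups $K_q$, $q\geq 0$ (boundary $\partial\colon K_{q+1}\to K_q$ with $\partial\partial=0$, $\partial=0$ on $K_0$, augmentation $\epsilon\colon K_0\to\mathbb{Z}$ with $\epsilon\partial=0$), together with a distinguished basis for each $K_q$. Members of the basis of $K_q$ are the $q$-dimensional basis elements. A "sum of basis elements" is a (possibly empty, possibly with repetitions) finite sum of basis elements; its terms are the basis elements occurring in it. For a chain $c$ write $\partial c=\partial^+c-\partial^-c$ where $\partial^+c,\partial^-c$ are sums of basis elements with no common terms; $(\partial^\pm)^r$ denotes the $r$-fold iterate of $\partial^\pm$. $K$ is *unital* if $\epsilon(\partial^-)^q a=\epsilon(\partial^+)^q a=1$ for each basis element $a$ of dimension $q$. $K$ is *loop-free* if its basis elements can be partially ordered so that, for any basis element $a$ and any integer $r>0$, the basis elements which are terms in $(\partial^-)^r a$ (strictly) precede those which are terms in $(\partial^+)^r a$. The members of $\nu K$ are the double sequences $(\,x_0^-,x_0^+\mid x_1^-,x_1^+\mid\ldots\,)$ such that $x_q^-$ and $x_q^+$ are sums of $q$-dimensional basis elements, finitely many terms of the double sequence are non-zero, $\epsilon x_0^-=\epsilon x_0^+=1$, and $\partial x_q^-=\partial x_q^+=x_{q-1}^+-x_{q-1}^-$ for $q>0$. For $x\in\nu K$, $q\geq 0$ and a sign $\alpha$, write $x_{q+1}^\alpha=a_1+\ldots+a_k$ as a sum of basis elements; then $g_q^\alpha(x)$ is the $q$-chain $$g_q^\alpha(x)=x_q^-+\partial^+a_1+\ldots+\partial^+a_k=\partial^-a_1+\ldots+\partial^-a_k+x_q^+$$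 (the two expressions are equal because $\partial x_{q+1}^\alpha=x_q^+-x_q^-$). A *network* consists of finite sets $E$ (edges) and $V$ (vertices), subsets $I\subseteq E$ (input edges) and $O\subseteq E$ (output edges), and functions $s\colon E\setminus I\to V$, $t\colon E\setminus O\to V$ (source and target); thus input edges are exactly the edges without a source, and output edges exactly the edges without a target. A *path* from an edge $e'$ to an edge $e$ is a sequence $e_0,v_1,e_1,\dots,v_k,e_k$ ($k\ge 0$) of edges $e_r$ and vertices $v_r$ with $v_r=t(e_{r-1})=s(e_r)$, $e_0=e'$, $e_k=e$. A network is *acyclic* if there is no path from any edge $e$ to itself other than the single-term path $e$; it is *linear* if it is acyclic and consists of a single path (all its edges and vertices are those of one path). A network is empty if it has no edges and no vertices. *)

theory Defs
  imports "HOL-Algebra.Free_Abelian_Groups" "HOL-Library.Multiset"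
begin

section \<open>Free augmented directed complexes\<close>

text \<open>
  The chain group \<open>K\<^sub>q\<close> is the free abelian group on its distinguished basis \<open>basis K q\<close>.
  Basis elements of different dimensions are different, so the groups \<open>K\<^sub>q\<close>, as subgroups
  of \<open>'a \<Rightarrow>\<^sub>0 int\<close>, meet only in \<open>0\<close>; hence one function \<open>bd K\<close> can serve as the boundary
  in every degree.  Its values on non-homogeneous elements are irrelevant.
\<close>

record 'a fadc =
  basis :: "nat \<Rightarrow> 'a set"
  bd :: "('a \<Rightarrow>\<^sub>0 int) \<Rightarrow> ('a \<Rightarrow>\<^sub>0 int)"
  aug :: "('a \<Rightarrow>\<^sub>0 int) \<Rightarrow> int"

abbreviation chain_grp :: "'a fadc \<Rightarrow> nat \<Rightarrow> ('a \<Rightarrow>\<^sub>0 int) monoid"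
  where "chain_grp K q \<equiv> free_Abelian_group (basis K q)"

definition free_adc :: "'a fadc \<Rightarrow> bool" where
  "free_adc K \<longleftrightarrow>
     (\<forall>p q. p \<noteq> q \<longrightarrow> basis K p \<inter> basis K q = {}) \<and>
     (\<forall>q. bd K \<in> hom (chain_grp K (Suc q)) (chain_grp K q)) \<and>
     (\<forall>q. \<forall>c \<in> carrier (chain_grp K (Suc q)). bd K (bd K c) = 0) \<and>
     (\<forall>c \<in> carrier (chain_grp K 0). bd K c = 0) \<and>
     aug K \<in> hom (chain_grp K 0) integer_group \<and>
     (\<forall>c \<in> carrier (chain_grp K 1). aug K (bd K c) = 0)"

text \<open>
  Sums of basis elements may be empty and may have repetitions.  Since the basis elements are
  linearly independent, the terms of a sum \<open>c\<close> are recovered as \<open>Poly_Mapping.keys c\<close>.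
\<close>

definition basis_sum :: "'a fadc \<Rightarrow> nat \<Rightarrow> ('a \<Rightarrow>\<^sub>0 int) \<Rightarrow> bool" where
  "basis_sum K q c \<longleftrightarrow> (\<exists>M. set_mset M \<subseteq> basis K q \<and> c = (\<Sum>a\<in>#M. frag_of a))"

abbreviation terms :: "('a \<Rightarrow>\<^sub>0 int) \<Rightarrow> 'a set" where
  "terms c \<equiv> Poly_Mapping.keys c"

lemma lookup_sum_mset_frag_of:
  "Poly_Mapping.lookup (\<Sum>a\<in>#M. frag_of a) b = int (count M b)"
  by (induction M) (auto simp: lookup_add)

lemma terms_sum_mset_frag_of: "terms (\<Sum>a\<in>#M. frag_of a) = set_mset M"
  by (auto simp: in_keys_iff lookup_sum_mset_frag_of count_eq_zero_iff)

lemma basis_sum_iff: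
  "basis_sum K q c \<longleftrightarrow> terms c \<subseteq> basis K q \<and> (\<forall>a. Poly_Mapping.lookup c a \<ge> 0)"
proof
  assume "basis_sum K q c"
  then show "terms c \<subseteq> basis K q \<and> (\<forall>a. Poly_Mapping.lookup c a \<ge> 0)"
    unfolding basis_sum_def by (metis lookup_sum_mset_frag_of terms_sum_mset_frag_of of_nat_0_le_iff)
next
  assume c: "terms c \<subseteq> basis K q \<and> (\<forall>a. Poly_Mapping.lookup c a \<ge> 0)"
  define M where "M = Abs_multiset (\<lambda>a. nat (Poly_Mapping.lookup c a))"
  have "finite {a. 0 < nat (Poly_Mapping.lookup c a)}"
    by (rule finite_subset[OF _ finite_keys[of c]]) (auto simp: in_keys_iff)
  then have count: "count M a = nat (Poly_Mapping.lookup c a)" for a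
    by (simp add: M_def Abs_multiset_inverse)
  have eq: "c = (\<Sum>a\<in>#M. frag_of a)"
    by (rule poly_mapping_eqI) (use c in \<open>simp add: lookup_sum_mset_frag_of count\<close>)
  moreover have "set_mset M \<subseteq> basis K q"
    using c eq terms_sum_mset_frag_of by metis
  ultimately show "basis_sum K q c"
    unfolding basis_sum_def by blast
qed


section \<open>The operations \<open>\<partial>\<^sup>-\<close> and \<open>\<partial>\<^sup>+\<close>\<close>

datatype sign = Minus | Plus

text \<open>
  The positive and negative parts of \<open>\<partial>c\<close>; lemma \<open>bd_part_unique\<close> below identifies them as the
  unique sums of basis elements without common terms whose difference is \<open>\<partial>c\<close>.
\<close>

fun bd_part :: "'a fadc \<Rightarrow> sign \<Rightarrow> ('a \<Rightarrow>\<^sub>0 int) \<Rightarrow> ('a \<Rightarrow>\<^sub>0 int)" where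
  "bd_part K Plus c = Poly_Mapping.map (\<lambda>n. max n 0) (bd K c)"
| "bd_part K Minus c = Poly_Mapping.map (\<lambda>n. max n 0) (- bd K c)"

lemma lookup_bd_part:
  "Poly_Mapping.lookup (bd_part K Plus c) a = max (Poly_Mapping.lookup (bd K c) a) 0"
  "Poly_Mapping.lookup (bd_part K Minus c) a = max (- Poly_Mapping.lookup (bd K c) a) 0"
  by (auto simp: Poly_Mapping.map.rep_eq when_def)

lemma bd_part_diff: "bd K c = bd_part K Plus c - bd_part K Minus c"
  by (rule poly_mapping_eqI) (simp add: lookup_minus lookup_bd_part del: bd_part.simps)

lemma bd_part_unique:
  assumes "free_adc K" and "c \<in> carrier (chain_grp K (Suc q))"
  shows "basis_sum K q p \<and> basis_sum K q m \<and> terms p \<inter> terms m = {} \<and> bd K c = p - m \<longleftrightarrow>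
         p = bd_part K Plus c \<and> m = bd_part K Minus c" (is "?L \<longleftrightarrow> ?R")
proof
  assume L: ?L
  have "Poly_Mapping.lookup p a = max (Poly_Mapping.lookup (bd K c) a) 0 \<and>
        Poly_Mapping.lookup m a = max (- Poly_Mapping.lookup (bd K c) a) 0" for a
  proof -
    have "Poly_Mapping.lookup (bd K c) a = Poly_Mapping.lookup p a - Poly_Mapping.lookup m a"
      using L by (simp add: lookup_minus)
    moreover have "Poly_Mapping.lookup p a \<ge> 0" "Poly_Mapping.lookup m a \<ge> 0"
      using L by (auto simp: basis_sum_iff)
    moreover have "Poly_Mapping.lookup p a = 0 \<or> Poly_Mapping.lookup m a = 0"
      using L by (auto simp: in_keys_iff)
    ultimately show ?thesis by auto
  qed
  then show ?R
    by (auto intro!: poly_mapping_eqI simp: lookup_bd_part simp del: bd_part.simps)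
next
  assume R: ?R
  have "bd K \<in> hom (chain_grp K (Suc q)) (chain_grp K q)"
    using assms(1) by (simp add: free_adc_def)
  then have "bd K c \<in> carrier (chain_grp K q)"
    using assms(2) by (rule hom_in_carrier)
  then have "terms (bd K c) \<subseteq> basis K q"
    by (simp add: free_Abelian_group_def)
  moreover have "terms (bd_part K s c) \<subseteq> terms (bd K c)" for s
    by (cases s) (auto simp: in_keys_iff lookup_bd_part simp del: bd_part.simps)
  ultimately have "terms (bd_part K s c) \<subseteq> basis K q" for s
    by blast
  then show ?L
    using R bd_part_diff[of K c]
    by (auto simp: basis_sum_iff lookup_bd_part in_keys_iff simp del: bd_part.simps)
qed

definition unital :: "'a fadc \<Rightarrow> bool" where
  "unital K \<longleftrightarrow>
     (\<forall>q. \<forall>a \<in> basis K q. \<forall>\<alpha>. aug K ((bd_part K \<alpha> ^^ q) (frag_of a)) = 1)"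

definition loop_free :: "'a fadc \<Rightarrow> bool" where
  "loop_free K \<longleftrightarrow>
     (\<exists>r. partial_order_on (\<Union>q. basis K q) r \<and>
       (\<forall>a \<in> \<Union>q. basis K q. \<forall>n > 0.
          \<forall>b \<in> terms ((bd_part K Minus ^^ n) (frag_of a)).
          \<forall>c \<in> terms ((bd_part K Plus ^^ n) (frag_of a)). (b, c) \<in> r \<and> b \<noteq> c))"


section \<open>The double sequences in \<open>\<nu>K\<close> and the chains \<open>g\<^sub>q\<^sup>\<alpha>(x)\<close>\<close>

definition nu :: "'a fadc \<Rightarrow> (nat \<Rightarrow> sign \<Rightarrow> ('a \<Rightarrow>\<^sub>0 int)) set" where
  "nu K = {x.
     (\<forall>q \<alpha>. basis_sum K q (x q \<alpha>)) \<and>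
     finite {(q, \<alpha>). x q \<alpha> \<noteq> 0} \<and>
     (\<forall>\<alpha>. aug K (x 0 \<alpha>) = 1) \<and>
     (\<forall>q > 0. \<forall>\<alpha>. bd K (x q \<alpha>) = x (q - 1) Plus - x (q - 1) Minus)}"

text \<open>
  If \<open>x (Suc q) \<alpha> = a\<^sub>1 + \<dots> + a\<^sub>k\<close> then the \<open>frag_extend\<close> term below is
  \<open>\<partial>\<^sup>+a\<^sub>1 + \<dots> + \<partial>\<^sup>+a\<^sub>k\<close>, with repeated \<open>a\<^sub>i\<close> counted as often as they occur
  (lemma \<open>frag_extend_sum_mset\<close>); it is not \<open>\<partial>\<^sup>+(a\<^sub>1 + \<dots> + a\<^sub>k)\<close>, as \<open>\<partial>\<^sup>+\<close> is not additive.
\<close>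

definition g_chain ::
  "'a fadc \<Rightarrow> (nat \<Rightarrow> sign \<Rightarrow> ('a \<Rightarrow>\<^sub>0 int)) \<Rightarrow> nat \<Rightarrow> sign \<Rightarrow> ('a \<Rightarrow>\<^sub>0 int)" where
  "g_chain K x q \<alpha> = x q Minus + frag_extend (\<lambda>a. bd_part K Plus (frag_of a)) (x (Suc q) \<alpha>)"

lemma frag_extend_sum_mset:
  "frag_extend f (\<Sum>a\<in>#M. frag_of a) = (\<Sum>a\<in>#M. f a)"
  by (induction M) (simp_all add: frag_extend_add)

lemma g_chain_alt:
  assumes K: "free_adc K" and x: "x \<in> nu K"
  shows "g_chain K x q \<alpha> = frag_extend (\<lambda>a. bd_part K Minus (frag_of a)) (x (Suc q) \<alpha>) + x q Plus"
proof -
  have hom: "bd K \<in> hom (chain_grp K (Suc q)) (chain_grp K q)"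
    using K by (simp add: free_adc_def)
  have bd_add: "bd K (c + d) = bd K c + bd K d"
    if "terms c \<subseteq> basis K (Suc q)" "terms d \<subseteq> basis K (Suc q)" for c d
    using hom_mult[OF hom, of c d] that by (simp add: free_Abelian_group_def)
  obtain M where M: "set_mset M \<subseteq> basis K (Suc q)" "x (Suc q) \<alpha> = (\<Sum>a\<in>#M. frag_of a)"
    using x unfolding nu_def basis_sum_def by blast
  have "(\<Sum>a\<in>#M. bd_part K Plus (frag_of a)) - (\<Sum>a\<in>#M. bd_part K Minus (frag_of a)) =
        bd K (\<Sum>a\<in>#M. frag_of a)"
    using M(1)
  proof (induction M)
    case empty
    then show ?case using bd_add[of 0 0] by simp
  next
    case (add a M)
    then have "bd K (frag_of a + (\<Sum>a\<in>#M. frag_of a)) =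
               bd K (frag_of a) + bd K (\<Sum>a\<in>#M. frag_of a)"
      by (intro bd_add) (auto simp: terms_sum_mset_frag_of)
    then show ?case
      using add bd_part_diff[of K "frag_of a"] by (simp del: bd_part.simps add: algebra_simps)
  qed
  also have "\<dots> = x q Plus - x q Minus"
    using x M(2) by (simp add: nu_def flip: M(2))
  finally show ?thesis
    unfolding g_chain_def M(2) frag_extend_sum_mset
    by (simp del: bd_part.simps add: algebra_simps)
qed


section \<open>Networks\<close>

text \<open>The functions \<open>src\<close> and \<open>tgt\<close> are only meaningful off \<open>inputs\<close> and \<open>outputs\<close>, respectively.\<close>

record ('e, 'v) network =
  edges :: "'e set"
  verts :: "'v set"
  inputs :: "'e set"
  outputs :: "'e set"
  src :: "'e \<Rightarrow> 'v"
  tgt :: "'e \<Rightarrow> 'v"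

definition is_network :: "('e, 'v) network \<Rightarrow> bool" where
  "is_network N \<longleftrightarrow>
     finite (edges N) \<and> finite (verts N) \<and>
     inputs N \<subseteq> edges N \<and> outputs N \<subseteq> edges N \<and>
     src N \<in> edges N - inputs N \<rightarrow> verts N \<and>
     tgt N \<in> edges N - outputs N \<rightarrow> verts N"

definition edges_into :: "('e, 'v) network \<Rightarrow> 'v \<Rightarrow> 'e set" where
  "edges_into N v = {e \<in> edges N - outputs N. tgt N e = v}"

definition edges_from :: "('e, 'v) network \<Rightarrow> 'v \<Rightarrow> 'e set" where
  "edges_from N v = {e \<in> edges N - inputs N. src N e = v}"

text \<open>
  The path \<open>e\<^sub>0, v\<^sub>1, e\<^sub>1, \<dots>, v\<^sub>k, e\<^sub>k\<close> is given by the list of its edges and the list of its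
  vertices, so that \<open>vs ! i\<close> is \<open>v\<^sub>i\<^sub>+\<^sub>1\<close>.
\<close>

definition network_path :: "('e, 'v) network \<Rightarrow> 'e list \<Rightarrow> 'v list \<Rightarrow> bool" where
  "network_path N es vs \<longleftrightarrow>
     length es = Suc (length vs) \<and> set es \<subseteq> edges N \<and>
     (\<forall>i < length vs. es ! i \<in> edges_into N (vs ! i) \<and> es ! Suc i \<in> edges_from N (vs ! i))"

definition acyclic_network :: "('e, 'v) network \<Rightarrow> bool" where
  "acyclic_network N \<longleftrightarrow>
     (\<forall>e es vs. network_path N es vs \<and> hd es = e \<and> last es = e \<longrightarrow> es = [e] \<and> vs = [])"

definition linear_network :: "('e, 'v) network \<Rightarrow> bool" where
  "linear_network N \<longleftrightarrow>
     acyclic_network N \<and>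
     (\<exists>es vs. network_path N es vs \<and> edges N = set es \<and> verts N = set vs)"

definition empty_network :: "('e, 'v) network \<Rightarrow> bool" where
  "empty_network N \<longleftrightarrow> edges N = {} \<and> verts N = {}"

text \<open>
  \<open>N\<close> has the properties required of the network \<open>G\<^sub>q\<^sup>\<alpha>(x)\<close>, where \<open>ce\<close> and \<open>cv\<close> send edges and
  vertices to the basis elements to which they correspond.
\<close>

definition realizes ::
  "'a fadc \<Rightarrow> (nat \<Rightarrow> sign \<Rightarrow> ('a \<Rightarrow>\<^sub>0 int)) \<Rightarrow> nat \<Rightarrow> sign \<Rightarrow>
     ('e, 'v) network \<Rightarrow> ('e \<Rightarrow> 'a) \<Rightarrow> ('v \<Rightarrow> 'a) \<Rightarrow> bool" where
  "realizes K x q \<alpha> N ce cv \<longleftrightarrow>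
     is_network N \<and>
     bij_betw ce (edges N) (terms (g_chain K x q \<alpha>)) \<and>
     bij_betw cv (verts N) (terms (x (Suc q) \<alpha>)) \<and>
     (\<forall>v \<in> verts N.
        bij_betw ce (edges_into N v) (terms (bd_part K Minus (frag_of (cv v)))) \<and>
        bij_betw ce (edges_from N v) (terms (bd_part K Plus (frag_of (cv v)))))"

end

theory Submission
  imports Defs
begin

text \<open>
  The heart of the matter is that all coefficients of \<open>g\<^sub>q\<^sup>\<alpha>(x)\<close> are at most \<open>1\<close>; then every edge has
  at most one source and at most one target.  Given a term \<open>b\<close>, let \<open>w\<close> be the part of
  \<open>x\<^sub>q\<^sub>+\<^sub>1\<^sup>\<alpha>\<close> consisting of those \<open>a\<close> for which some term of \<open>\<partial>\<^sup>+a\<close> precedes or equals \<open>b\<close>.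
  By loop-freeness the chain \<open>y = x\<^sub>q\<^sup>- + \<partial>w\<close> is again a sum of basis elements, and its coefficient
  at \<open>b\<close> is that of \<open>g\<^sub>q\<^sup>\<alpha>(x)\<close>, since every element producing \<open>b\<close> has been applied and none
  consuming it.  Replacing \<open>x\<^sub>q\<^sup>\<plusminus>\<close> by \<open>y\<close> and truncating gives a member of \<open>\<nu>K\<close>, so it suffices
  to bound the coefficients of the chains \<open>x\<^sub>q\<^sup>\<alpha>\<close>.  That goes by induction on \<open>q\<close>: for \<open>q = 0\<close> use
  the augmentation, and in the step a repeated term of \<open>x\<^sub>q\<^sub>+\<^sub>1\<^sup>\<alpha>\<close> would produce one in \<open>g\<^sub>q\<^sup>\<alpha>(x)\<close>,
  as \<open>\<partial>\<^sup>+a\<close> is never zero.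

  The order on basis elements increases strictly along paths, whence acyclicity.
\<close>

declare bd_part.simps [simp del]

section \<open>Linear networks\<close>

text \<open>A longest path from the unique input exhausts the network: an \<open>R\<close>-minimal
  edge off it would have its predecessor on it, and unique outgoing edges exclude branching.\<close>

lemma linear_networkI:
  assumes N: "is_network N" and s: "inputs N = {s}"
    and into: "\<And>v. v \<in> verts N \<Longrightarrow> \<exists>e. edges_into N v = {e}"
    and out: "\<And>v. v \<in> verts N \<Longrightarrow> \<exists>e. edges_from N v = {e}"
    and R: "trans R" "irrefl R"
    and step: "\<And>v e f. e \<in> edges_into N v \<Longrightarrow> f \<in> edges_from N v \<Longrightarrow> (e, f) \<in> R"
    and acyc: "acyclic_network N"
  shows "linear_network N"
proof -
  \<comment> \<open>\<open>P n\<close> asks for a path from \<open>s\<close> through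
    \<open>n\<close> vertices. Its edges are distinct because \<open>R\<close> increases strictly
    along it, and this bounds \<open>n\<close>.\<close>
  define P where "P n \<longleftrightarrow> (\<exists>es vs. network_path N es vs \<and> hd es = s \<and> length vs = n)" for n
  have fin: "finite (edges N)" and sE: "s \<in> edges N"
    using N s by (auto simp: is_network_def)
  have bound: "n \<le> card (edges N)" if "P n" for n
  proof -
    obtain es vs where p: "network_path N es vs" "length vs = n"
      using \<open>P n\<close> unfolding P_def by blast
    have "sorted_wrt (\<lambda>e f. (e, f) \<in> R) es"
      using p R(1) step by (subst sorted_wrt_iff_nth_Suc_transp)
        (auto simp: network_path_def trans_def intro: transpI)
    then have "distinct es"
      using R(2) by (auto simp: sorted_wrt_iff_nth_less distinct_conv_nth irrefl_def)
        (metis linorder_neqE_nat)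
    then have "Suc n = card (set es)"
      using p by (simp add: network_path_def distinct_card)
    also have "\<dots> \<le> card (edges N)"
      using p fin by (simp add: network_path_def card_mono)
    finally show ?thesis by simp
  qed
  have "P 0"
    unfolding P_def network_path_def using sE by (intro exI[of _ "[s]"] exI[of _ "[]"]) auto
  define n where "n = (GREATEST n. P n)"
  have max: "m \<le> n" if "P m" for m
    unfolding n_def using that bound by (rule Greatest_le_nat)
  have "P n"
    unfolding n_def using \<open>P 0\<close> bound by (rule GreatestI_nat)
  then obtain es vs where p: "network_path N es vs" "hd es = s" "length vs = n"
    unfolding P_def by blast
  have len: "length es = Suc n" and esE: "set es \<subseteq> edges N"
    and path: "\<And>i. i < n \<Longrightarrow> es ! i \<in> edges_into N (vs ! i) \<and> es ! Suc i \<in> edges_from N (vs ! i)"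
    using p by (auto simp: network_path_def)
  have sub: "edges_into N v \<subseteq> edges N" "edges_from N v \<subseteq> edges N" for v
    by (auto simp: edges_into_def edges_from_def)
  text \<open>The end of a longest path from \<open>s\<close> has no target, as otherwise the path could be extended.\<close>
  have follow: "\<exists>i<n. vs ! i = v \<and> es ! Suc i \<in> edges_from N v"
    if "v \<in> verts N" and e: "e \<in> edges_into N v" "e \<in> set es" for v e
  proof -
    obtain i where i: "i < Suc n" "es ! i = e"
      using e(2) len by (metis in_set_conv_nth)
    show ?thesis
    proof (cases "i < n")
      case True
      then have "vs ! i = v"
        using path[of i] i e(1) by (auto simp: edges_into_def)
      then show ?thesis using path True by auto
    next
      case False
      obtain f where f: "edges_from N v = {f}" using out \<open>v \<in> verts N\<close> by blast
      have "es ! n \<in> edges_into N v" using False i e(1) by (auto simp: less_Suc_eq)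
      then have "network_path N (es @ [f]) (vs @ [v])"
        using p len path f esE sub(2)[of v]
        by (auto simp: network_path_def nth_append less_Suc_eq)
      moreover have "hd (es @ [f]) = s"
        using p(2) len by (cases es) auto
      ultimately have "P (Suc n)" unfolding P_def using p(3) by fastforce
      then show ?thesis using max by fastforce
    qed
  qed
  have all_edges: "edges N \<subseteq> set es"
  proof (rule ccontr)
    assume "\<not> edges N \<subseteq> set es"
    then have ne: "edges N - set es \<noteq> {}" by blast
    \<comment> \<open>A strict order on a finite set is well-founded, which yields a minimal edge
      \<open>f\<close> off the path.\<close>
    have "wf (R \<inter> edges N \<times> edges N)"
    proof (rule finite_acyclic_wf)
      show "finite (R \<inter> edges N \<times> edges N)" using fin by blast
      have "trans (R \<inter> edges N \<times> edges N)" using R(1) by (auto simp: trans_def)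
      then show "acyclic (R \<inter> edges N \<times> edges N)"
        using R(2) by (auto simp: acyclic_irrefl irrefl_def)
    qed
    then obtain f where f: "f \<in> edges N - set es"
      and f_min: "\<And>e. (e, f) \<in> R \<inter> edges N \<times> edges N \<Longrightarrow> e \<notin> edges N - set es"
      using ne by (metis wfE_min ex_in_conv)
    have "s \<in> set es" using p(2) len by (cases es) auto
    then have "f \<notin> inputs N" using f s by auto
    then have v: "src N f \<in> verts N" "f \<in> edges_from N (src N f)"
      using f N by (auto simp: is_network_def edges_from_def)
    then obtain e where e: "edges_into N (src N f) = {e}" using into by blast
    then have "(e, f) \<in> R \<inter> edges N \<times> edges N"
      using step v(2) f sub(1)[of "src N f"] by auto
    then have "e \<in> set es" using f_min by blast
    \<comment> \<open>After \<open>e\<close> the path leaves the source of \<open>f\<close>, and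
      \<open>f\<close> is the only edge it can take there.\<close>
    then obtain i where "i < n" "es ! Suc i \<in> edges_from N (src N f)"
      using follow[of "src N f" e] v e by blast
    moreover have "edges_from N (src N f) = {f}" using out[OF v(1)] v(2) by auto
    ultimately show False using f len by (metis DiffD2 Suc_less_eq nth_mem singletonD)
  qed
  have "v \<in> set vs" if v: "v \<in> verts N" for v
  proof -
    obtain e where "edges_into N v = {e}" using into \<open>v \<in> verts N\<close> by blast
    then obtain i where "i < n" "vs ! i = v"
      using follow[of v e] v all_edges sub(1)[of v] by auto
    then show ?thesis using p(3) by auto
  qed
  moreover have "v \<in> verts N" if v: "v \<in> set vs" for v
  proof -
    obtain i where i: "i < n" "v = vs ! i" using v p(3) by (metis in_set_conv_nth)
    then have "es ! i \<in> edges_into N v" using path by blast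
    then show ?thesis using N by (auto simp: edges_into_def is_network_def)
  qed
  ultimately have "verts N = set vs" by blast
  with all_edges esE p(1) acyc show ?thesis
    unfolding linear_network_def by blast
qed

text \<open>The first and last edges of a path with at least one vertex are related by
  \<open>R\<close>, hence different.\<close>

lemma acyclic_networkI:
  assumes R: "trans R" "irrefl R"
    and step: "\<And>v e f. e \<in> edges_into N v \<Longrightarrow> f \<in> edges_from N v \<Longrightarrow> (e, f) \<in> R"
  shows "acyclic_network N"
  unfolding acyclic_network_def
proof (intro allI impI)
  fix e es vs
  assume p: "network_path N es vs \<and> hd es = e \<and> last es = e"
  then have len: "length es = Suc (length vs)" by (simp add: network_path_def)
  have "sorted_wrt (\<lambda>e f. (e, f) \<in> R) es"
    using p R(1) step by (subst sorted_wrt_iff_nth_Suc_transp)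
      (auto simp: network_path_def trans_def intro: transpI)
  moreover have "hd es = es ! 0" "last es = es ! length vs"
    using len by (auto simp: hd_conv_nth last_conv_nth simp flip: length_greater_0_conv)
  ultimately have "\<not> 0 < length vs"
    using p R(2) len unfolding sorted_wrt_iff_nth_less irrefl_def by (metis lessI)
  then show "es = [e] \<and> vs = []"
    using p len by (auto simp: length_Suc_conv)
qed


section \<open>Coefficients\<close>

lemma lookup_frag_extend:
  "Poly_Mapping.lookup (frag_extend f c) b =
     (\<Sum>a\<in>terms c. Poly_Mapping.lookup c a * Poly_Mapping.lookup (f a) b)"
  by (simp add: frag_extend_def lookup_sum)

text \<open>\<open>R\<close> will be the strict part of the order given by loop-freeness;
  \<open>step_R\<close> is the case of a single boundary.\<close>

locale loop_free_unital_adc =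
  fixes K :: "'a fadc" and R :: "('a \<times> 'a) set"
  assumes free: "free_adc K" and unital: "unital K"
    and trans_R: "trans R" and irrefl_R: "irrefl R"
    and step_R: "\<And>q a b c. a \<in> basis K q \<Longrightarrow> b \<in> terms (bd_part K Minus (frag_of a)) \<Longrightarrow>
                   c \<in> terms (bd_part K Plus (frag_of a)) \<Longrightarrow> (b, c) \<in> R"
begin

section \<open>Additivity and unitality\<close>

lemma bd_hom: "bd K \<in> hom (chain_grp K (Suc q)) (chain_grp K q)"
  using free by (simp add: free_adc_def)

lemma bd_frag_extend:
  assumes "terms c \<subseteq> basis K (Suc q)"
  shows "bd K c = frag_extend (\<lambda>a. bd K (frag_of a)) c"
proof -
  \<comment> \<open>Membership is carried through the induction because additivity of
    \<open>bd K\<close> is available only within one chain group.\<close>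
  have "terms c \<subseteq> basis K (Suc q) \<and> bd K c = frag_extend (\<lambda>a. bd K (frag_of a)) c"
    using assms
  proof (induction rule: frag_induction)
    case zero
    then show ?case using hom_frag_diff[OF bd_hom, of 0 q 0] by simp
  next
    case (diff a b)
    then show ?case
      using hom_frag_diff[OF bd_hom, of a q b] keys_diff[of a b]
      by (auto simp: frag_extend_diff)
  qed auto
  then show ?thesis ..
qed

lemma bd_0 [simp]: "bd K 0 = 0"
  using bd_frag_extend[of 0 0] by simp

lemma bd_part_0 [simp]: "bd_part K \<alpha> 0 = 0"
  by (cases \<alpha>) (auto intro!: poly_mapping_eqI simp: lookup_bd_part)

lemma aug_0 [simp]: "aug K 0 = 0"
proof -
  have "aug K \<in> hom (chain_grp K 0) integer_group"
    using free by (simp add: free_adc_def)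
  from hom_mult[OF this, of 0 0] show ?thesis by simp
qed

lemma aug_sum_mset:
  "set_mset M \<subseteq> basis K 0 \<Longrightarrow> aug K (\<Sum>a\<in>#M. frag_of a) = int (size M)"
proof (induction M)
  case (add a M)
  have "aug K \<in> hom (chain_grp K 0) integer_group"
    using free by (simp add: free_adc_def)
  then have "aug K (frag_of a + (\<Sum>a\<in>#M. frag_of a)) =
      aug K (frag_of a) + aug K (\<Sum>a\<in>#M. frag_of a)"
    using hom_mult[of "aug K" "chain_grp K 0" integer_group "frag_of a" "\<Sum>a\<in>#M. frag_of a"]
      add.prems by (simp add: terms_sum_mset_frag_of)
  \<comment> \<open>This is unitality in dimension 0, where the iterate is empty.\<close>
  moreover have "aug K (frag_of a) = 1"
    using unital add.prems unfolding unital_def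
    by (metis funpow_0 insert_subset set_mset_add_mset_insert)
  ultimately show ?case using add by simp
qed simp

text \<open>The augmentation counts summands with repetition, so there is exactly one. This starts
  the induction for the coefficient bound and gives linearity in degree 0.\<close>

lemma aug_eq_1:
  assumes "basis_sum K 0 c" "aug K c = 1"
  obtains a where "a \<in> basis K 0" "c = frag_of a"
proof -
  obtain M where M: "set_mset M \<subseteq> basis K 0" "c = (\<Sum>a\<in>#M. frag_of a)"
    using assms(1) by (auto simp: basis_sum_def)
  then have "size M = 1" using aug_sum_mset assms(2) by simp
  then obtain a where "M = {#a#}" using size_1_singleton_mset by blast
  then show ?thesis using M that by simp
qed

lemma basis_sum_bd_part:
  assumes "a \<in> basis K (Suc q)"
  shows "basis_sum K q (bd_part K \<alpha> (frag_of a))"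
  using bd_part_unique[OF free, of "frag_of a" q] assms by (cases \<alpha>) auto

lemma bd_part_nonneg: "0 \<le> Poly_Mapping.lookup (bd_part K \<alpha> c) a"
  by (cases \<alpha>) (simp_all add: lookup_bd_part)

text \<open>If it vanished, so would the iterate whose augmentation unitality requires to be
  1.\<close>

lemma bd_part_nonzero:
  assumes "a \<in> basis K (Suc q)"
  shows "bd_part K \<alpha> (frag_of a) \<noteq> 0"
proof
  assume "bd_part K \<alpha> (frag_of a) = 0"
  moreover have "(bd_part K \<alpha> ^^ n) 0 = 0" for n
    by (induction n) auto
  ultimately have "(bd_part K \<alpha> ^^ Suc q) (frag_of a) = 0"
    by (simp add: funpow_Suc_right del: funpow.simps)
  then show False using unital assms unfolding unital_def by (metis aug_0 zero_neq_one)
qed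

section \<open>Coefficients of members of \<open>nu K\<close> and of \<open>g_chain\<close>\<close>

lemma nu_basis_sum: "x \<in> nu K \<Longrightarrow> basis_sum K q (x q \<alpha>)"
  by (simp add: nu_def)

lemma nu_aug: "x \<in> nu K \<Longrightarrow> aug K (x 0 \<alpha>) = 1"
  by (simp add: nu_def)

lemma nu_nonneg: "x \<in> nu K \<Longrightarrow> 0 \<le> Poly_Mapping.lookup (x q \<alpha>) a"
  using nu_basis_sum[of x q \<alpha>] by (simp add: basis_sum_iff)

lemma nu_terms: "x \<in> nu K \<Longrightarrow> terms (x q \<alpha>) \<subseteq> basis K q"
  using nu_basis_sum[of x q \<alpha>] by (simp add: basis_sum_iff)

lemma nu_pos: "x \<in> nu K \<Longrightarrow> a \<in> terms (x q \<alpha>) \<Longrightarrow> 1 \<le> Poly_Mapping.lookup (x q \<alpha>) a"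
  using nu_nonneg[of x q \<alpha> a] by (simp add: in_keys_iff)

lemma bd_part_pos: "b \<in> terms (bd_part K \<alpha> c) \<Longrightarrow> 1 \<le> Poly_Mapping.lookup (bd_part K \<alpha> c) b"
  using bd_part_nonneg[of \<alpha> c b] by (simp add: in_keys_iff)

text \<open>In either expression for \<open>g_chain\<close>, the parts
  \<open>bd_part K \<beta>\<close> accompany the chain of sign \<open>opposite \<beta>\<close>. One
  argument thus covers both sources and targets.\<close>

fun opposite :: "sign \<Rightarrow> sign" where
  "opposite Plus = Minus" | "opposite Minus = Plus"

lemma g_chain_eq:
  assumes "x \<in> nu K"
  shows "g_chain K x q \<alpha> =
    x q (opposite \<beta>) + frag_extend (\<lambda>a. bd_part K \<beta> (frag_of a)) (x (Suc q) \<alpha>)"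
  using g_chain_alt[OF free assms] by (cases \<beta>) (simp_all add: g_chain_def)

lemma lookup_g_chain:
  assumes "x \<in> nu K"
  shows "Poly_Mapping.lookup (g_chain K x q \<alpha>) b = Poly_Mapping.lookup (x q (opposite \<beta>)) b +
    (\<Sum>a\<in>terms (x (Suc q) \<alpha>). Poly_Mapping.lookup (x (Suc q) \<alpha>) a *
       Poly_Mapping.lookup (bd_part K \<beta> (frag_of a)) b)"
  by (simp add: g_chain_eq[OF assms, of q \<alpha> \<beta>] lookup_add lookup_frag_extend)

lemma summand_nonneg:
  assumes "x \<in> nu K"
  shows "0 \<le> Poly_Mapping.lookup (x p \<alpha>) a * Poly_Mapping.lookup (bd_part K \<beta> c) b"
  using assms by (simp add: nu_nonneg bd_part_nonneg)

lemma summand_pos: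
  assumes "x \<in> nu K" "a \<in> terms (x p \<alpha>)" "b \<in> terms (bd_part K \<beta> c)"
  shows "1 \<le> Poly_Mapping.lookup (x p \<alpha>) a * Poly_Mapping.lookup (bd_part K \<beta> c) b"
  using mult_mono[OF nu_pos[OF assms(1,2)] bd_part_pos[OF assms(3)]] nu_nonneg[OF assms(1)] by simp

section \<open>The coefficient bound\<close>

lemma g_chain_le_1_if_nu_le_1:
  assumes le_1: "\<And>z a. z \<in> nu K \<Longrightarrow> Poly_Mapping.lookup (z q Minus) a \<le> 1" and x: "x \<in> nu K"
  shows "Poly_Mapping.lookup (g_chain K x q \<alpha>) b \<le> 1"
proof -
  let ?X = "x (Suc q) \<alpha>"
  let ?d = "\<lambda>\<beta> a. bd_part K \<beta> (frag_of a)"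
  \<comment> \<open>The reflexive closure admits the elements that produce \<open>b\<close>
    itself.\<close>
  define F where "F = {a. \<exists>c\<in>terms (?d Plus a). (c, b) \<in> R\<^sup>=}"
  define w where "w = frag_extend (\<lambda>a. if a \<in> F then frag_of a else 0) ?X"
  define y where "y = x q Minus + bd K w"
  have lookup_w: "Poly_Mapping.lookup w a = (if a \<in> F then Poly_Mapping.lookup ?X a else 0)" for a
  proof -
    have "Poly_Mapping.lookup w a =
        (\<Sum>i\<in>terms ?X. if i = a then (if a \<in> F then Poly_Mapping.lookup ?X a else 0) else 0)"
      unfolding w_def lookup_frag_extend by (rule sum.cong) auto
    then show ?thesis by (simp add: in_keys_iff)
  qed
  then have terms_w: "terms w = terms ?X \<inter> F"
    by (auto simp: in_keys_iff split: if_splits)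
  then have w_basis: "terms w \<subseteq> basis K (Suc q)"
    using nu_terms[OF x] by blast
  have X_basis: "a \<in> basis K (Suc q)" if "a \<in> terms ?X" for a
    using nu_terms[OF x] that by blast
  \<comment> \<open>\<open>D \<beta> A c\<close> is the contribution of the elements of
    \<open>A\<close> to the coefficient at \<open>c\<close> through their boundary parts of sign
    \<open>\<beta>\<close>, weighted by their multiplicities in \<open>?X\<close>.\<close>
  define D where
    "D \<beta> A c = (\<Sum>a\<in>A. Poly_Mapping.lookup ?X a * Poly_Mapping.lookup (?d \<beta> a) c)" for \<beta> A c
  have D_nonneg: "0 \<le> D \<beta> A c" for \<beta> A c
    unfolding D_def using summand_nonneg[OF x] by (intro sum_nonneg) blast
  have D_split: "D \<beta> (terms ?X) c = D \<beta> (terms ?X \<inter> F) c + D \<beta> (terms ?X - F) c" for \<beta> c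
    unfolding D_def by (rule sum.Int_Diff) simp
  have D_zero: "D \<beta> A c = 0" if "\<And>a. a \<in> A \<Longrightarrow> c \<notin> terms (?d \<beta> a)" for \<beta> A c
    unfolding D_def using that by (intro sum.neutral) (auto simp: in_keys_iff)
  have lookup_y: "Poly_Mapping.lookup y c =
      Poly_Mapping.lookup (x q Minus) c + D Plus (terms ?X \<inter> F) c - D Minus (terms ?X \<inter> F) c" for c
  proof -
    have "Poly_Mapping.lookup (bd K w) c =
        (\<Sum>a\<in>terms ?X \<inter> F. Poly_Mapping.lookup ?X a * Poly_Mapping.lookup (?d Plus a - ?d Minus a) c)"
      unfolding bd_frag_extend[OF w_basis] lookup_frag_extend terms_w
      by (rule sum.cong) (auto simp: lookup_w simp flip: bd_part_diff)
    then show ?thesis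
      by (simp add: y_def lookup_add D_def lookup_minus right_diff_distrib sum_subtractf)
  qed
  have g: "Poly_Mapping.lookup (g_chain K x q \<alpha>) c =
      Poly_Mapping.lookup (x q (opposite \<beta>)) c + D \<beta> (terms ?X) c" for \<beta> c
    unfolding D_def by (rule lookup_g_chain[OF x])
  text \<open>An element of \<open>F\<close> can consume \<open>c\<close> only if all elements producing \<open>c\<close> belong to \<open>F\<close>.\<close>
  have y_nonneg: "0 \<le> Poly_Mapping.lookup y c" for c
  proof (cases "\<exists>a\<in>terms ?X \<inter> F. c \<in> terms (?d Minus a)")
    case False
    then show ?thesis
      using D_zero[of "terms ?X \<inter> F" c Minus] D_nonneg nu_nonneg[OF x] lookup_y by simp
  next
    case True
    then obtain a e where a: "a \<in> terms ?X" "c \<in> terms (?d Minus a)"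
      and e: "e \<in> terms (?d Plus a)" "(e, b) \<in> R\<^sup>="
      by (auto simp: F_def)
    have "(c, e) \<in> R" using step_R[OF X_basis] a e by blast
    then have "(c, b) \<in> R" using e trans_R by (auto elim: transE)
    then have "D Plus (terms ?X - F) c = 0"
      by (intro D_zero) (auto simp: F_def)
    \<comment> \<open>Equating the two expressions for the coefficient of \<open>g_chain\<close>
      turns that of \<open>y\<close> into a sum without subtraction.\<close>
    then have "Poly_Mapping.lookup y c =
        Poly_Mapping.lookup (x q Plus) c + D Minus (terms ?X - F) c"
      using g[of c Plus] g[of c Minus] D_split[of Plus c] D_split[of Minus c] lookup_y[of c] by simp
    then show ?thesis using D_nonneg nu_nonneg[OF x] by simp
  qed
  have y_b: "Poly_Mapping.lookup y b = Poly_Mapping.lookup (g_chain K x q \<alpha>) b"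
  proof -
    have "D Plus (terms ?X - F) b = 0"
      by (intro D_zero) (auto simp: F_def)
    moreover have "D Minus (terms ?X \<inter> F) b = 0"
    proof (rule D_zero)
      fix a assume a: "a \<in> terms ?X \<inter> F"
      then obtain e where e: "e \<in> terms (?d Plus a)" "(e, b) \<in> R\<^sup>=" by (auto simp: F_def)
      show "b \<notin> terms (?d Minus a)"
      proof
        assume "b \<in> terms (?d Minus a)"
        then have "(b, e) \<in> R" using step_R[OF X_basis] a e by blast
        then have "(b, b) \<in> R" using e trans_R by (auto elim: transE)
        then show False using irrefl_R by (simp add: irrefl_def)
      qed
    qed
    ultimately show ?thesis
      using g[of b Plus] D_split[of Plus b] lookup_y[of b] by simp
  qed
  have bd_w: "terms (bd K w) \<subseteq> basis K q"
    using hom_in_carrier[OF bd_hom, of w q] w_basis by simp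
  have y_sum: "basis_sum K q y"
    unfolding basis_sum_iff y_def
    using y_nonneg keys_add[of "x q Minus" "bd K w"] nu_terms[OF x, of q Minus] bd_w
    by (auto simp: y_def)
  \<comment> \<open>With \<open>y\<close> for both signs in degree \<open>q\<close>, the boundary
    required in degree \<open>Suc q\<close> is \<open>y - y = 0\<close>, so the sequence may stop
    there.\<close>
  define z where "z p \<beta> = (if p < q then x p \<beta> else if p = q then y else 0)" for p \<beta>
  have "z \<in> nu K"
    unfolding nu_def
  proof (intro CollectI conjI allI impI)
    show "basis_sum K p (z p \<beta>)" for p \<beta>
      using y_sum nu_basis_sum[OF x] by (auto simp: z_def basis_sum_iff)
    have "{(p, \<beta>). z p \<beta> \<noteq> 0} \<subseteq> {..q} \<times> {Minus, Plus}"
      by (auto simp: z_def split: if_splits) (metis sign.exhaust)+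
    then show "finite {(p, \<beta>). z p \<beta> \<noteq> 0}"
      by (rule finite_subset) simp
    show "aug K (z 0 \<beta>) = 1" for \<beta>
    proof (cases "q = 0")
      case False
      then show ?thesis using x by (simp add: z_def nu_def)
    next
      case True
      have "aug K \<in> hom (chain_grp K 0) integer_group"
        and "aug K (bd K w) = 0"
        using free w_basis True by (auto simp: free_adc_def)
      then have "aug K y = aug K (x 0 Minus)"
        using hom_mult[of "aug K" "chain_grp K 0" integer_group "x 0 Minus" "bd K w"]
          nu_terms[OF x, of 0 Minus] bd_w True by (simp add: y_def)
      then show ?thesis using x True by (simp add: z_def nu_def)
    qed
    show "bd K (z p \<beta>) = z (p - 1) Plus - z (p - 1) Minus" if "p > 0" for p \<beta>
    proof -
      have "bd K y = x (q - 1) Plus - x (q - 1) Minus" if "q > 0"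
      proof -
        obtain q' where q: "q = Suc q'" using \<open>q > 0\<close> gr0_conv_Suc by auto
        \<comment> \<open>Since \<open>y\<close> differs from \<open>x q Minus\<close> by a
          boundary, both have the same boundary.\<close>
        have "bd K (bd K w) = 0"
          using free w_basis by (auto simp: free_adc_def)
        then have "bd K y = bd K (x q Minus)"
          using hom_mult[OF bd_hom, of "x q Minus" q' "bd K w"]
            nu_terms[OF x, of q Minus] bd_w q by (simp add: y_def)
        then show ?thesis using x \<open>q > 0\<close> by (simp add: nu_def)
      qed
      moreover have "bd K (x p \<beta>) = x (p - 1) Plus - x (p - 1) Minus"
        using x \<open>p > 0\<close> unfolding nu_def by blast
      ultimately show ?thesis using \<open>p > 0\<close> by (auto simp: z_def)
    qed
  qed
  \<comment> \<open>The assumed bound is applied to \<open>z\<close> rather than to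
    \<open>x\<close>, which is why it is stated for all members of \<open>nu K\<close>.\<close>
  from le_1[OF this, of b] show ?thesis by (simp add: z_def y_b)
qed

lemma nu_le_1:
  assumes "x \<in> nu K"
  shows "Poly_Mapping.lookup (x q \<alpha>) a \<le> 1"
  using assms
\<comment> \<open>\<open>x\<close> must vary, since the bound in degree \<open>q\<close> is needed
  for modified sequences too.\<close>
proof (induction q arbitrary: x \<alpha> a)
  case 0
  obtain c where "x 0 \<alpha> = frag_of c"
    using aug_eq_1[OF nu_basis_sum[OF 0] nu_aug[OF 0]] by blast
  then show ?case by simp
next
  case (Suc q)
  show ?case
  proof (cases "a \<in> terms (x (Suc q) \<alpha>)")
    case True
    then have "a \<in> basis K (Suc q)" using nu_terms[OF Suc.prems] by blast
    then obtain b where b: "b \<in> terms (bd_part K Plus (frag_of a))"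
      using bd_part_nonzero by fastforce
    let ?f = "\<lambda>a. Poly_Mapping.lookup (x (Suc q) \<alpha>) a *
      Poly_Mapping.lookup (bd_part K Plus (frag_of a)) b"
    \<comment> \<open>As \<open>b\<close> has coefficient at least 1 in the boundary part, the
      multiplicity of \<open>a\<close> is at most its contribution at \<open>b\<close>.\<close>
    have "Poly_Mapping.lookup (x (Suc q) \<alpha>) a \<le> ?f a"
      using mult_left_mono[OF bd_part_pos[OF b] nu_nonneg[OF Suc.prems, of "Suc q" \<alpha> a]] by simp
    also have "\<dots> \<le> sum ?f (terms (x (Suc q) \<alpha>))"
      using True summand_nonneg[OF Suc.prems] by (intro member_le_sum) auto
    also have "\<dots> \<le> Poly_Mapping.lookup (g_chain K x q \<alpha>) b"
      using lookup_g_chain[OF Suc.prems, of q \<alpha> b Plus] nu_nonneg[OF Suc.prems] by simp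
    also have "\<dots> \<le> 1"
      using g_chain_le_1_if_nu_le_1 Suc by blast
    finally show ?thesis .
  qed (simp add: in_keys_iff)
qed

lemma g_chain_le_1: "x \<in> nu K \<Longrightarrow> Poly_Mapping.lookup (g_chain K x q \<alpha>) b \<le> 1"
  using g_chain_le_1_if_nu_le_1 nu_le_1 by blast

section \<open>Incidence between terms\<close>

lemma terms_g_chain:
  assumes "x \<in> nu K"
  shows "terms (g_chain K x q \<alpha>) = terms (x q (opposite \<beta>)) \<union>
    (\<Union>a\<in>terms (x (Suc q) \<alpha>). terms (bd_part K \<beta> (frag_of a)))"
proof -
  have "b \<in> terms (g_chain K x q \<alpha>) \<longleftrightarrow> b \<in> terms (x q (opposite \<beta>)) \<or>
      (\<exists>a\<in>terms (x (Suc q) \<alpha>). b \<in> terms (bd_part K \<beta> (frag_of a)))" for b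
  proof -
    let ?f = "\<lambda>a. Poly_Mapping.lookup (x (Suc q) \<alpha>) a *
      Poly_Mapping.lookup (bd_part K \<beta> (frag_of a)) b"
    \<comment> \<open>All contributions are nonnegative, so no term is lost by cancellation.\<close>
    have "0 \<le> sum ?f (terms (x (Suc q) \<alpha>))"
      using summand_nonneg[OF assms] by (intro sum_nonneg) blast
    moreover have "sum ?f (terms (x (Suc q) \<alpha>)) = 0 \<longleftrightarrow>
        (\<forall>a\<in>terms (x (Suc q) \<alpha>). b \<notin> terms (bd_part K \<beta> (frag_of a)))"
      using summand_nonneg[OF assms]
      by (subst sum_nonneg_eq_0_iff) (auto simp: in_keys_iff)
    ultimately show ?thesis
      using lookup_g_chain[OF assms, of q \<alpha> b \<beta>] nu_nonneg[OF assms, of q "opposite \<beta>" b]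
      by (auto simp: in_keys_iff)
  qed
  then show ?thesis by blast
qed

text \<open>Two different elements would give \<open>b\<close> coefficient at least 2 in
  \<open>g_chain\<close>. So an edge has at most one source and at most one target.\<close>

lemma incident_unique:
  assumes x: "x \<in> nu K" and "a \<in> terms (x (Suc q) \<alpha>)" "a' \<in> terms (x (Suc q) \<alpha>)"
    and "b \<in> terms (bd_part K \<beta> (frag_of a))" "b \<in> terms (bd_part K \<beta> (frag_of a'))"
  shows "a = a'"
proof (rule ccontr)
  let ?f = "\<lambda>a. Poly_Mapping.lookup (x (Suc q) \<alpha>) a *
    Poly_Mapping.lookup (bd_part K \<beta> (frag_of a)) b"
  assume "a \<noteq> a'"
  then have "2 \<le> sum ?f {a, a'}"
    using summand_pos[OF x assms(2,4)] summand_pos[OF x assms(3,5)] by simp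
  also have "\<dots> \<le> sum ?f (terms (x (Suc q) \<alpha>))"
    using assms summand_nonneg[OF x] by (intro sum_mono2) auto
  also have "\<dots> \<le> 1"
    using lookup_g_chain[OF x, of q \<alpha> b \<beta>] nu_nonneg[OF x, of q "opposite \<beta>" b]
      g_chain_le_1[OF x, of q \<alpha> b] by simp
  finally show False by simp
qed

text \<open>Again \<open>b\<close> would be counted twice in \<open>g_chain\<close>. So input edges
  have no source and output edges no target.\<close>

lemma extremal_not_incident:
  assumes x: "x \<in> nu K" and "a \<in> terms (x (Suc q) \<alpha>)" "b \<in> terms (bd_part K \<beta> (frag_of a))"
  shows "b \<notin> terms (x q (opposite \<beta>))"
proof
  let ?f = "\<lambda>a. Poly_Mapping.lookup (x (Suc q) \<alpha>) a *
    Poly_Mapping.lookup (bd_part K \<beta> (frag_of a)) b"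
  assume "b \<in> terms (x q (opposite \<beta>))"
  then have "2 \<le> Poly_Mapping.lookup (x q (opposite \<beta>)) b + ?f a"
    using nu_pos[OF x, of b q "opposite \<beta>"] summand_pos[OF assms] by simp
  also have "?f a \<le> sum ?f (terms (x (Suc q) \<alpha>))"
    using assms summand_nonneg[OF x] by (intro member_le_sum) auto
  also have "Poly_Mapping.lookup (x q (opposite \<beta>)) b + \<dots> \<le> 1"
    using lookup_g_chain[OF x, of q \<alpha> b \<beta>] g_chain_le_1[OF x, of q \<alpha> b] by simp
  finally show False by simp
qed


section \<open>The networks\<close>

text \<open>Basis elements serve as their own edges and vertices, so all correspondences are
  identities. By \<open>incident_unique\<close>, each choice has at most one candidate; where there
  is none, the value is arbitrary.\<close>

definition cell_network ::
  "(nat \<Rightarrow> sign \<Rightarrow> ('a \<Rightarrow>\<^sub>0 int)) \<Rightarrow> nat \<Rightarrow> sign \<Rightarrow> ('a, 'a) network" where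
  "cell_network x q \<alpha> = \<lparr>
     edges = terms (g_chain K x q \<alpha>),
     verts = terms (x (Suc q) \<alpha>),
     inputs = terms (x q Minus),
     outputs = terms (x q Plus),
     src = (\<lambda>e. SOME a. a \<in> terms (x (Suc q) \<alpha>) \<and> e \<in> terms (bd_part K Plus (frag_of a))),
     tgt = (\<lambda>e. SOME a. a \<in> terms (x (Suc q) \<alpha>) \<and> e \<in> terms (bd_part K Minus (frag_of a)))\<rparr>"

lemma cell_network_simps [simp]:
  "edges (cell_network x q \<alpha>) = terms (g_chain K x q \<alpha>)"
  "verts (cell_network x q \<alpha>) = terms (x (Suc q) \<alpha>)"
  "inputs (cell_network x q \<alpha>) = terms (x q Minus)"
  "outputs (cell_network x q \<alpha>) = terms (x q Plus)"
  by (simp_all add: cell_network_def)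

lemma
  assumes "x \<in> nu K"
    and "a \<in> terms (x (Suc q) \<alpha>)"
  shows src_cell_network:
      "e \<in> terms (bd_part K Plus (frag_of a)) \<Longrightarrow> src (cell_network x q \<alpha>) e = a"
    and tgt_cell_network:
      "e \<in> terms (bd_part K Minus (frag_of a)) \<Longrightarrow> tgt (cell_network x q \<alpha>) e = a"
  using assms by (auto simp: cell_network_def intro!: some_equality dest: incident_unique)

lemma is_network_cell_network:
  assumes x: "x \<in> nu K"
  shows "is_network (cell_network x q \<alpha>)"
proof -
  have "src (cell_network x q \<alpha>) e \<in> terms (x (Suc q) \<alpha>)"
    if e: "e \<in> terms (g_chain K x q \<alpha>)" "e \<notin> terms (x q Minus)" for e
  proof -
    obtain a where a: "a \<in> terms (x (Suc q) \<alpha>)" "e \<in> terms (bd_part K Plus (frag_of a))"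
      using e terms_g_chain[OF x, of q \<alpha> Plus] by auto
    then show ?thesis using src_cell_network[OF x a] by simp
  qed
  moreover have "tgt (cell_network x q \<alpha>) e \<in> terms (x (Suc q) \<alpha>)"
    if e: "e \<in> terms (g_chain K x q \<alpha>)" "e \<notin> terms (x q Plus)" for e
  proof -
    obtain a where a: "a \<in> terms (x (Suc q) \<alpha>)" "e \<in> terms (bd_part K Minus (frag_of a))"
      using e terms_g_chain[OF x, of q \<alpha> Minus] by auto
    then show ?thesis using tgt_cell_network[OF x a] by simp
  qed
  ultimately show ?thesis
    using terms_g_chain[OF x, of q \<alpha> Plus] terms_g_chain[OF x, of q \<alpha> Minus]
    by (auto simp: is_network_def)
qed

lemma edges_from_cell_network:
  assumes x: "x \<in> nu K" and a: "a \<in> terms (x (Suc q) \<alpha>)"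
  shows "edges_from (cell_network x q \<alpha>) a = terms (bd_part K Plus (frag_of a))"
proof (intro equalityI subsetI)
  fix e assume e: "e \<in> edges_from (cell_network x q \<alpha>) a"
  then obtain c where c: "c \<in> terms (x (Suc q) \<alpha>)" "e \<in> terms (bd_part K Plus (frag_of c))"
    using terms_g_chain[OF x, of q \<alpha> Plus] by (auto simp: edges_from_def)
  \<comment> \<open>The source of \<open>e\<close> is both \<open>a\<close> and \<open>c\<close>, so
    these coincide.\<close>
  then show "e \<in> terms (bd_part K Plus (frag_of a))"
    using e src_cell_network[OF x c] by (simp add: edges_from_def)
next
  fix e assume e: "e \<in> terms (bd_part K Plus (frag_of a))"
  then show "e \<in> edges_from (cell_network x q \<alpha>) a"
    using a terms_g_chain[OF x, of q \<alpha> Plus] extremal_not_incident[OF x a e]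
      src_cell_network[OF x a e] by (auto simp: edges_from_def)
qed

lemma edges_into_cell_network:
  assumes x: "x \<in> nu K" and a: "a \<in> terms (x (Suc q) \<alpha>)"
  shows "edges_into (cell_network x q \<alpha>) a = terms (bd_part K Minus (frag_of a))"
proof (intro equalityI subsetI)
  fix e assume e: "e \<in> edges_into (cell_network x q \<alpha>) a"
  then obtain c where c: "c \<in> terms (x (Suc q) \<alpha>)" "e \<in> terms (bd_part K Minus (frag_of c))"
    using terms_g_chain[OF x, of q \<alpha> Minus] by (auto simp: edges_into_def)
  then show "e \<in> terms (bd_part K Minus (frag_of a))"
    using e tgt_cell_network[OF x c] by (simp add: edges_into_def)
next
  fix e assume e: "e \<in> terms (bd_part K Minus (frag_of a))"
  then show "e \<in> edges_into (cell_network x q \<alpha>) a"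
    using a terms_g_chain[OF x, of q \<alpha> Minus] extremal_not_incident[OF x a e]
      tgt_cell_network[OF x a e] by (auto simp: edges_into_def)
qed

text \<open>This is where loop-freeness enters the acyclicity and linearity criteria.\<close>

lemma cell_network_step:
  assumes x: "x \<in> nu K"
    and e: "e \<in> edges_into (cell_network x q \<alpha>) a" and f: "f \<in> edges_from (cell_network x q \<alpha>) a"
  shows "(e, f) \<in> R"
proof -
  have a: "a \<in> terms (x (Suc q) \<alpha>)"
    using e is_network_cell_network[OF x, of q \<alpha>] by (auto simp: edges_into_def is_network_def)
  then show ?thesis
    using e f step_R nu_terms[OF x] edges_from_cell_network[OF x a] edges_into_cell_network[OF x a]
    by blast
qed

lemma acyclic_cell_network: "x \<in> nu K \<Longrightarrow> acyclic_network (cell_network x q \<alpha>)"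
  by (rule acyclic_networkI[OF trans_R irrefl_R cell_network_step])

lemma realizes_cell_network:
  assumes "x \<in> nu K"
  shows "realizes K x q \<alpha> (cell_network x q \<alpha>) id id"
  using assms is_network_cell_network
  by (auto simp: realizes_def edges_into_cell_network edges_from_cell_network)

lemma linear_cell_network:
  assumes x: "x \<in> nu K"
  shows "linear_network (cell_network x 0 \<alpha>)"
proof -
  obtain s where s: "x 0 Minus = frag_of s"
    using aug_eq_1[OF nu_basis_sum[OF x] nu_aug[OF x]] by blast
  \<comment> \<open>By unitality in dimension 1, each boundary part of \<open>v\<close> has
    augmentation 1 and is thus a single basis element.\<close>
  have "\<exists>e. terms (bd_part K \<beta> (frag_of v)) = {e}" if "v \<in> terms (x (Suc 0) \<alpha>)" for v \<beta>
  proof -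
    have v: "v \<in> basis K (Suc 0)" using that nu_terms[OF x] by blast
    then have "aug K ((bd_part K \<beta> ^^ Suc 0) (frag_of v)) = 1"
      using unital unfolding unital_def by blast
    then obtain e where "bd_part K \<beta> (frag_of v) = frag_of e"
      using aug_eq_1[OF basis_sum_bd_part[OF v]] by auto
    then show ?thesis by simp
  qed
  then show ?thesis
    using linear_networkI[OF is_network_cell_network[OF x] _ _ _ trans_R irrefl_R
        cell_network_step[OF x] acyclic_cell_network[OF x], of 0 \<alpha> s] s
    by (simp add: edges_into_cell_network[OF x] edges_from_cell_network[OF x])
qed

lemma eventually_empty_cell_network:
  assumes x: "x \<in> nu K"
  shows "\<exists>n. \<forall>q>n. \<forall>\<alpha>. empty_network (cell_network x q \<alpha>)"
proof -
  have "finite (fst ` {(q, \<alpha>). x q \<alpha> \<noteq> 0})"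
    using x by (simp add: nu_def)
  then obtain n where n: "\<And>q. q \<in> fst ` {(q, \<alpha>). x q \<alpha> \<noteq> 0} \<Longrightarrow> q \<le> n"
    unfolding finite_nat_set_iff_bounded_le by blast
  \<comment> \<open>Beyond \<open>n\<close> both \<open>x q\<close> and \<open>x (Suc q)\<close>
    vanish, hence so does \<open>g_chain\<close>.\<close>
  have "x q \<alpha> = 0" if "q > n" for q \<alpha>
    using n[of q] that by force
  then show ?thesis
    by (intro exI[of _ n]) (auto simp: empty_network_def g_chain_def)
qed

end

section \<open>Choice of the order and assembly\<close>

lemma loop_free_unital_adc_exists:
  assumes "free_adc K" "unital K" "loop_free K"
  obtains R where "loop_free_unital_adc K R"
proof -
  obtain r where r: "partial_order_on (\<Union>q. basis K q) r"
    and step: "\<And>a n b c. a \<in> (\<Union>q. basis K q) \<Longrightarrow> n > 0 \<Longrightarrow>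
      b \<in> terms ((bd_part K Minus ^^ n) (frag_of a)) \<Longrightarrow>
      c \<in> terms ((bd_part K Plus ^^ n) (frag_of a)) \<Longrightarrow> (b, c) \<in> r \<and> b \<noteq> c"
    using assms(3) unfolding loop_free_def by metis
  \<comment> \<open>Removing the diagonal makes the order irreflexive; antisymmetry keeps it
    transitive.\<close>
  have "loop_free_unital_adc K (r - Id)"
  proof
    show "trans (r - Id)"
      using r by (auto simp: partial_order_on_def preorder_on_def intro: trans_diff_Id)
    show "irrefl (r - Id)" by (simp add: irrefl_def)
    show "(b, c) \<in> r - Id" if "a \<in> basis K q" "b \<in> terms (bd_part K Minus (frag_of a))"
      "c \<in> terms (bd_part K Plus (frag_of a))" for q a b c
      using step[of a "Suc 0" b c] that by auto
  qed (use assms in auto)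
  then show ?thesis by (rule that)
qed

theorem theorem4p2:
  fixes K :: "'a fadc" and x :: "nat \<Rightarrow> sign \<Rightarrow> ('a \<Rightarrow>\<^sub>0 int)"
  assumes "free_adc K" and "unital K" and "loop_free K" and "x \<in> nu K"
  shows "\<exists>(G :: nat \<Rightarrow> sign \<Rightarrow> ('a, 'a) network)
            (ce :: nat \<Rightarrow> sign \<Rightarrow> 'a \<Rightarrow> 'a) (cv :: nat \<Rightarrow> sign \<Rightarrow> 'a \<Rightarrow> 'a).
    (\<forall>q \<alpha>. realizes K x q \<alpha> (G q \<alpha>) (ce q \<alpha>) (cv q \<alpha>)) \<and>
    (\<exists>n. \<forall>q > n. \<forall>\<alpha>. empty_network (G q \<alpha>)) \<and>
    (\<forall>q \<alpha>. acyclic_network (G q \<alpha>)) \<and>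
    (\<forall>\<alpha>. linear_network (G 0 \<alpha>)) \<and>
    (\<forall>q \<alpha>.
       bij_betw (ce (Suc q) \<alpha>) (inputs (G (Suc q) \<alpha>)) (terms (x (Suc q) Minus)) \<and>
       bij_betw (ce (Suc q) \<alpha>) (outputs (G (Suc q) \<alpha>)) (terms (x (Suc q) Plus)) \<and>
       bij_betw (inv_into (edges (G (Suc q) \<alpha>)) (ce (Suc q) \<alpha>) \<circ> cv q Minus)
         (verts (G q Minus)) (inputs (G (Suc q) \<alpha>)) \<and>
       bij_betw (inv_into (edges (G (Suc q) \<alpha>)) (ce (Suc q) \<alpha>) \<circ> cv q Plus)
         (verts (G q Plus)) (outputs (G (Suc q) \<alpha>)))"
proof -
  obtain R where "loop_free_unital_adc K R"
    using loop_free_unital_adc_exists assms(1-3) by blast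
  then interpret loop_free_unital_adc K R .
  note x = \<open>x \<in> nu K\<close>
  have bij: "bij_betw (inv_into (terms (g_chain K x (Suc q) \<alpha>)) id \<circ> id)
      (terms (x (Suc q) \<beta>)) (terms (x (Suc q) \<beta>))" for q \<alpha> \<beta>
  proof -
    \<comment> \<open>The terms of \<open>x (Suc q) \<beta>\<close> are edges in degree
      \<open>Suc q\<close>, so the inverse of the identity on edges fixes them.\<close>
    have "terms (x (Suc q) \<beta>) \<subseteq> terms (g_chain K x (Suc q) \<alpha>)"
      using terms_g_chain[OF x, of "Suc q" \<alpha> "opposite \<beta>"] by (cases \<beta>) auto
    then have "(inv_into (terms (g_chain K x (Suc q) \<alpha>)) id \<circ> id) a = id a"
      if "a \<in> terms (x (Suc q) \<beta>)" for a
      using inv_into_f_f[of id "terms (g_chain K x (Suc q) \<alpha>)" a] that by auto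
    then show ?thesis by (rule bij_betw_cong[THEN iffD2, OF _ bij_betw_id])
  qed
  show ?thesis
  proof (rule exI[of _ "cell_network x"], intro exI[of _ "\<lambda>_ _. id"] conjI allI)
    show "\<exists>n. \<forall>q>n. \<forall>\<alpha>. empty_network (cell_network x q \<alpha>)"
      by (rule eventually_empty_cell_network[OF x])
  qed (use x bij in \<open>simp_all add: realizes_cell_network acyclic_cell_network linear_cell_network\<close>)
qed

end
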